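(* Let $n\ge1$, let $G$ be the quaternionic Heisenberg group $H^n_{\mathbb H}$ or the octonionic Heisenberg group $H^n_{\mathbb O}$, and let $\mathfrak g$ be its Lie algebra with grading $\mathfrak g=V_1\oplus[\mathfrak g,\mathfrak g]$. Then there is an $n$-dimensional $\Omega$-regular, $\Omega$-isotropic subspace $S\subset V_1$.
   Context: Heisenberg groups. Let $\mathbb K$ be the Hamilton quaternions $\mathbb H$ or the Cayley octonions $\mathbb O$. The Heisenberg group $H^n_{\mathbb K}$ is the manifold $\mathbb K^n\times\operatorname{Im}\mathbb K$ with group law $(z,x)(w,y)=(z+w,\;x+y-\tfrac12\sum_{i=1}^n\operatorname{Im}(z_i\overline{w_i}))$. It is the simply connected $2$-step nilpotent Lie group with real Lie algebra (up to the isomorphism $(Z,X)\mapsto(Z,-X)$) $V_1\oplus V_2$, $V_1=\mathbb K^n$, $V_2=\operatorname{Im}\mathbb K$, with bracket $[(Z,X),(W,Y)]=(0,\sum_{i=1}^n\operatorname{Im}(Z_i\overline{W_i}))$. Curvature form. Let $N=\dim\mathfrak g$, $n_1=\dim V_1$. The left-invariant horizontal distribution spanned by $V_1$ is the set of common zeros of $1$-forms $\eta_1,\dots,\eta_{N-n_1}$ (one may take the left-invariant forms dual to the last $N-n_1$ vectors of a basis $b_1,\dots,b_N$ of $\mathfrak g$ with $V_1=\langle b_1,\dots,b_{n_1}\rangle$; then $d\eta_i(X,Y)=\tfrac12 b_{n_1+i}^*([X,Y])$ up to sign convention). Put $\omega_i=d\eta_i$ and $\Omega=(\omega_1,\dots,\omega_{N-n_1}):\Lambda^2V_1\to\mathfrak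 g/V_1\cong\mathbb R^{N-n_1}$. A subspace $S\subset V_1$ with basis $X_1,\dots,X_q$ is $\Omega$-regular if for every $(\sigma_{ij})\in\mathbb R^{(N-n_1)\times q}$ the system $\omega_i(\xi,X_j)=\sigma_{ij}$ ($1\le i\le N-n_1$, $1\le j\le q$) has a solution $\xi\in V_1$. It is $\Omega$-isotropic if $\Omega$ restricted to $\Lambda^2S$ is zero. *)

theory Defs
  imports "HOL-Analysis.Analysis"
begin

section \<open>Quaternions and octonions\<close>

text \<open>Cayley-Dickson doubling: \<open>(a, b)\<close> stands for \<open>a + b j\<close> in the quaternions and for
  \<open>p + q l\<close> in the octonions. Real coordinates of the imaginary part are kept in a type of their
  own, of dimension 3 resp. 7, so that the Heisenberg group is a full vector space type.\<close>

type_synonym quat = "complex \<times> complex"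
type_synonym im_quat = "real \<times> complex"
type_synonym octo = "quat \<times> quat"
type_synonym im_octo = "im_quat \<times> quat"

definition qmul :: "quat \<Rightarrow> quat \<Rightarrow> quat" where
  "qmul p q = (fst p * fst q - cnj (snd q) * snd p, snd q * fst p + snd p * cnj (fst q))"

definition qcnj :: "quat \<Rightarrow> quat" where
  "qcnj p = (cnj (fst p), - snd p)"

definition qim :: "quat \<Rightarrow> im_quat" where
  "qim p = (Im (fst p), snd p)"

definition omul :: "octo \<Rightarrow> octo \<Rightarrow> octo" where
  "omul p q = (qmul (fst p) (fst q) - qmul (qcnj (snd q)) (snd p),
               qmul (snd q) (fst p) + qmul (snd p) (qcnj (fst q)))"

definition ocnj :: "octo \<Rightarrow> octo" where
  "ocnj p = (qcnj (fst p), - snd p)"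

definition oim :: "octo \<Rightarrow> im_octo" where
  "oim p = (qim (fst p), snd p)"


section \<open>Regular and isotropic subspaces\<close>

text \<open>\<open>\<omega> 0, \<dots>, \<omega> (m - 1)\<close> are the components of the form \<open>\<Omega>\<close> on \<open>V\<close>. Regularity does not
  depend on the basis of \<open>S\<close>; it is asked for all of them.\<close>

definition Omega_regular ::
    "'g::euclidean_space set \<Rightarrow> nat \<Rightarrow> (nat \<Rightarrow> 'g \<Rightarrow> 'g \<Rightarrow> real) \<Rightarrow> 'g set \<Rightarrow> bool" where
  "Omega_regular V m \<omega> S \<longleftrightarrow>
     (\<forall>B. independent B \<and> span B = S \<longrightarrow>
        (\<forall>\<sigma> :: nat \<Rightarrow> 'g \<Rightarrow> real. \<exists>\<xi>\<in>V. \<forall>i<m. \<forall>X\<in>B. \<omega> i \<xi> X = \<sigma> i X))"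

definition Omega_isotropic ::
    "nat \<Rightarrow> (nat \<Rightarrow> 'g::euclidean_space \<Rightarrow> 'g \<Rightarrow> real) \<Rightarrow> 'g set \<Rightarrow> bool" where
  "Omega_isotropic m \<omega> S \<longleftrightarrow> (\<forall>i<m. \<forall>X\<in>S. \<forall>Y\<in>S. \<omega> i X Y = 0)"


section \<open>One-forms on a vector space\<close>

text \<open>The factor 1/2 is part of the convention for the exterior derivative.\<close>

definition ext_deriv ::
    "('g::real_normed_vector \<Rightarrow> 'g \<Rightarrow> real) \<Rightarrow> 'g \<Rightarrow> 'g \<Rightarrow> 'g \<Rightarrow> real" where
  "ext_deriv \<eta> p X Y =
     (frechet_derivative (\<lambda>q. \<eta> q Y) (at p) X - frechet_derivative (\<lambda>q. \<eta> q X) (at p) Y) / 2"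


section \<open>Heisenberg groups\<close>

locale heisenberg =
  fixes mul :: "'k::euclidean_space \<Rightarrow> 'k \<Rightarrow> 'k" (infixl "\<odot>" 70)
    and cj :: "'k \<Rightarrow> 'k"
    and im :: "'k \<Rightarrow> 'v::euclidean_space"
    and one :: 'k
  assumes bilinear_mul: "bilinear mul"
    and linear_cj: "linear cj"
    and linear_im: "linear im"
    and surj_im: "surj im"
    and mul_one: "z \<odot> one = z"
    and cj_one: "cj one = one"
    and cj_cj: "cj (cj z) = z"
    and cj_mul: "cj (z \<odot> w) = cj w \<odot> cj z"
    and im_cj: "im (cj z) = - im z"
begin

definition herm :: "'k^'n \<Rightarrow> 'k^'n \<Rightarrow> 'v" where
  "herm z w = (\<Sum>i\<in>UNIV. im (z $ i \<odot> cj (w $ i)))"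

definition gmult :: "('k^'n) \<times> 'v \<Rightarrow> ('k^'n) \<times> 'v \<Rightarrow> ('k^'n) \<times> 'v" where
  "gmult p q = (fst p + fst q, snd p + snd q - (1/2) *\<^sub>R herm (fst p) (fst q))"

text \<open>The identity of the group is \<open>0\<close>, and the Lie algebra is the tangent space at \<open>0\<close>,
  i.e. again the type \<open>('k^'n) \<times> 'v\<close>.\<close>

definition left_field :: "('k^'n) \<times> 'v \<Rightarrow> ('k^'n) \<times> 'v \<Rightarrow> ('k^'n) \<times> 'v" where
  "left_field X p = frechet_derivative (gmult p) (at 0) X"

definition lie_bracket :: "('k^'n) \<times> 'v \<Rightarrow> ('k^'n) \<times> 'v \<Rightarrow> ('k^'n) \<times> 'v" where
  "lie_bracket X Y =
     frechet_derivative (left_field Y) (at 0) X - frechet_derivative (left_field X) (at 0) Y"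

definition V1 :: "(('k^'n) \<times> 'v) set" where
  "V1 = UNIV \<times> {0}"

definition left_invariant_form :: "(('k^'n) \<times> 'v \<Rightarrow> ('k^'n) \<times> 'v \<Rightarrow> real) \<Rightarrow> bool" where
  "left_invariant_form \<eta> \<longleftrightarrow>
     (\<forall>p. linear (\<eta> p)) \<and>
     (\<forall>p q X. \<eta> (gmult p q) (frechet_derivative (gmult p) (at q) X) = \<eta> q X)"

text \<open>Left-invariant forms \<open>\<eta> 0, \<dots>, \<eta> (m - 1)\<close>, where \<open>m\<close> is the codimension of \<open>V1\<close>, whose
  common zeros are the left-invariant distribution spanned by \<open>V1\<close>.\<close>

definition horizontal_coframe ::
    "nat \<Rightarrow> (nat \<Rightarrow> ('k^'n) \<times> 'v \<Rightarrow> ('k^'n) \<times> 'v \<Rightarrow> real) \<Rightarrow> bool" where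
  "horizontal_coframe m \<eta> \<longleftrightarrow>
     m = DIM(('k^'n) \<times> 'v) - dim (V1 :: (('k^'n) \<times> 'v) set) \<and>
     (\<forall>i<m. left_invariant_form (\<eta> i)) \<and>
     (\<forall>p. {X. \<forall>i<m. \<eta> i p X = 0} = (\<lambda>X. left_field X p) ` V1)"

definition curvature ::
    "(nat \<Rightarrow> ('k^'n) \<times> 'v \<Rightarrow> ('k^'n) \<times> 'v \<Rightarrow> real) \<Rightarrow> nat \<Rightarrow>
     ('k^'n) \<times> 'v \<Rightarrow> ('k^'n) \<times> 'v \<Rightarrow> real" where
  "curvature \<eta> i = ext_deriv (\<eta> i) 0"

end

context heisenberg
begin

interpretation mul: bounded_bilinear mul
  using bilinear_mul by (simp add: bilinear_conv_bounded_bilinear)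

interpretation cj: bounded_linear cj
  using linear_cj by (simp add: linear_conv_bounded_linear)

interpretation im: bounded_linear im
  using linear_im by (simp add: linear_conv_bounded_linear)

lemma herm_linear:
  "herm (x + y) w = herm x w + herm y w" "herm (r *\<^sub>R x) w = r *\<^sub>R herm x w"
  "herm z (x + y) = herm z x + herm z y" "herm z (r *\<^sub>R x) = r *\<^sub>R herm z x"
  "herm 0 w = 0" "herm z 0 = 0"
  by (simp_all add: herm_def mul.add_left mul.add_right mul.scaleR_left mul.scaleR_right mul.zero_left
      mul.zero_right cj.add cj.scaleR cj.zero im.add im.scaleR im.zero sum.distrib scaleR_sum_right)

lemma herm_swap: "herm w z = - herm z w"
proof -
  have "im (a \<odot> cj b) = - im (b \<odot> cj a)" for a b
    using im_cj[of "b \<odot> cj a"] by (simp add: cj_mul cj_cj)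
  then show ?thesis
    unfolding herm_def sum_negf[symmetric] by (intro sum.cong refl)
qed

lemma frechet_derivative_affine:
  fixes f :: "'a::euclidean_space \<Rightarrow> 'b::euclidean_space"
  assumes "linear f" and "\<And>x. g x = c + f x"
  shows "frechet_derivative g (at x) = f"
proof -
  have "(g has_derivative (\<lambda>x. 0 + f x)) (at x)"
    unfolding assms(2)[abs_def]
    by (intro has_derivative_add has_derivative_const bounded_linear_imp_has_derivative)
      (use assms(1) linear_conv_bounded_linear in blast)
  then show ?thesis
    using frechet_derivative_at by fastforce
qed

lemma frechet_derivative_gmult:
  "frechet_derivative (gmult p) (at q) = (\<lambda>X. (fst X, snd X - (1/2) *\<^sub>R herm (fst p) (fst X)))"
  by (rule frechet_derivative_affine[where c = p])
    (auto intro!: linearI simp: herm_linear gmult_def prod_eq_iff algebra_simps)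

lemma left_field_eq: "left_field X p = (fst X, snd X - (1/2) *\<^sub>R herm (fst p) (fst X))"
  by (simp add: left_field_def frechet_derivative_gmult)

lemma frechet_derivative_left_field:
  "frechet_derivative (left_field Y) (at p) = (\<lambda>X. (0, - (1/2) *\<^sub>R herm (fst X) (fst Y)))"
  by (rule frechet_derivative_affine[where c = Y])
    (auto intro!: linearI simp: herm_linear left_field_eq prod_eq_iff algebra_simps)

text \<open>The bracket of the usual description, up to the isomorphism \<open>(Z, X) \<mapsto> (Z, -X)\<close>.\<close>

lemma lie_bracket_eq:
  "lie_bracket X Y = (0, - herm (fst X) (fst Y))"
proof -
  have "lie_bracket X Y = (0, - ((1/2) *\<^sub>R herm (fst X) (fst Y) + (1/2) *\<^sub>R herm (fst X) (fst Y)))"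
    using herm_swap[of "fst Y" "fst X"]
    by (simp add: lie_bracket_def frechet_derivative_left_field)
  also have "\<dots> = (0, - herm (fst X) (fst Y))"
    by (simp flip: scaleR_add_left)
  finally show ?thesis .
qed

lemma range_lie_bracket:
  "span (range (\<lambda>(X, Y). lie_bracket X Y)) = (({0} \<times> UNIV) :: (('k^'n) \<times> 'v) set)"
proof -
  obtain i0 :: 'n where True by blast
  have "(0, v) \<in> range (\<lambda>(X, Y). lie_bracket X Y :: ('k^'n) \<times> 'v)" for v
  proof -
    obtain z where z: "im z = - v" using surj_im by (metis surjD)
    have "lie_bracket ((\<chi> i. if i = i0 then z else 0), 0) ((\<chi> i. one), 0) = (0, v)"
      by (simp add: lie_bracket_eq herm_def cj_one mul_one z if_distrib[of im] im.zero cong: if_cong)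
    then show ?thesis by (metis (mono_tags) case_prod_conv rangeI)
  qed
  then have "range (\<lambda>(X, Y). lie_bracket X Y) = (({0} \<times> UNIV) :: (('k^'n) \<times> 'v) set)"
    by (auto simp: lie_bracket_eq)
  moreover have "subspace (({0} \<times> UNIV) :: (('k^'n) \<times> 'v) set)"
    by (auto simp: subspace_def zero_prod_def)
  ultimately show ?thesis by (metis span_eq_iff)
qed

lemma grading:
  fixes T :: "(('k^'n) \<times> 'v) set"
  defines "T \<equiv> span (range (\<lambda>(X, Y). lie_bracket X Y))"
  shows "V1 \<inter> T = {0}" and "{X + Y |X Y. X \<in> V1 \<and> Y \<in> T} = UNIV"
  unfolding T_def range_lie_bracket V1_def by (auto simp: zero_prod_def)

lemma ext_deriv_left_invariant:
  assumes "left_invariant_form \<eta>"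
  shows "ext_deriv \<eta> 0 X Y = - \<eta> 0 (lie_bracket X Y) / 2"
proof -
  have lin: "linear (\<eta> 0)"
    using assms unfolding left_invariant_form_def by blast
  have inv: "\<eta> p (left_field Y p) = \<eta> 0 Y" for p Y
  proof -
    have "\<eta> (gmult p 0) (frechet_derivative (gmult p) (at 0) Y) = \<eta> 0 Y"
      using assms unfolding left_invariant_form_def by blast
    then show ?thesis
      by (simp add: gmult_def herm_linear left_field_def)
  qed
  have eq: "\<eta> p Y = \<eta> 0 Y + \<eta> 0 (0, (1/2) *\<^sub>R herm (fst p) (fst Y))" for p Y
    using inv[of p "(fst Y, snd Y + (1/2) *\<^sub>R herm (fst p) (fst Y))"]
    by (simp add: left_field_eq flip: linear_add[OF lin])
      (cases Y, simp)
  have "frechet_derivative (\<lambda>p. \<eta> p Y) (at 0) = (\<lambda>X. \<eta> 0 (0, (1/2) *\<^sub>R herm (fst X) (fst Y)))" for Y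
  proof (rule frechet_derivative_affine[where c = "\<eta> 0 Y"])
    show "linear (\<lambda>X. \<eta> 0 (0, (1/2) *\<^sub>R herm (fst X) (fst Y)))"
      by (rule linear_compose[OF _ lin, unfolded o_def])
        (auto intro!: linearI simp: herm_linear prod_eq_iff algebra_simps)
  qed (rule eq)
  then have "ext_deriv \<eta> 0 X Y =
      \<eta> 0 ((0, (1/2) *\<^sub>R herm (fst X) (fst Y)) - (0, (1/2) *\<^sub>R herm (fst Y) (fst X))) / 2"
    by (simp only: ext_deriv_def linear_diff[OF lin])
  also have "(0, (1/2) *\<^sub>R herm (fst X) (fst Y)) - (0, (1/2) *\<^sub>R herm (fst Y) (fst X))
      = - lie_bracket X Y"
    by (simp add: lie_bracket_def frechet_derivative_left_field)
  finally show ?thesis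
    by (simp add: linear_neg[OF lin])
qed

lemma horizontal_coframe_exists:
  "\<exists>m (\<eta> :: nat \<Rightarrow> ('k^'n) \<times> 'v \<Rightarrow> ('k^'n) \<times> 'v \<Rightarrow> real). horizontal_coframe m \<eta>"
proof -
  define d where "d = DIM('v)"
  obtain e where e: "bij_betw e {..<d} (Basis :: 'v set)"
    unfolding d_def using ex_bij_betw_nat_finite[OF finite_Basis, unfolded atLeast0LessThan] ..
  define \<theta> where "\<theta> p X = snd X + (1/2) *\<^sub>R herm (fst p) (fst X)" for p X :: "('k^'n) \<times> 'v"
  have dim: "DIM(('k^'n) \<times> 'v) - dim (V1 :: (('k^'n) \<times> 'v) set) = d"
  proof -
    have "dim ((UNIV :: ('k^'n) set) \<times> {0 :: 'v}) = dim (UNIV :: ('k^'n) set) + dim {0 :: 'v}"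
      by (rule dim_Times) (rule subspace_UNIV subspace_single_0)+
    then show ?thesis
      by (simp only: V1_def d_def dim_UNIV DIM_prod) simp
  qed
  have lin: "linear (\<theta> p)" for p
    by (rule linearI) (simp_all add: \<theta>_def herm_linear scaleR_add_right mult.commute)
  have inv: "\<theta> (gmult p q) (frechet_derivative (gmult p) (at q) X) = \<theta> q X" for p q X
    by (simp add: \<theta>_def frechet_derivative_gmult gmult_def herm_linear algebra_simps)
  have "{X. \<forall>i<d. \<theta> p X \<bullet> e i = 0} = (\<lambda>X. left_field X p) ` V1" for p
  proof -
    have "(\<forall>i<d. \<theta> p X \<bullet> e i = 0) \<longleftrightarrow> (\<forall>b\<in>Basis. \<theta> p X \<bullet> b = 0)" for X
      unfolding bij_betw_imp_surj_on[OF e, symmetric] by auto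
    then have "(\<forall>i<d. \<theta> p X \<bullet> e i = 0) \<longleftrightarrow> \<theta> p X = 0" for X
      by (simp add: euclidean_all_zero_iff)
    moreover have "\<theta> p X = 0 \<longleftrightarrow> X \<in> (\<lambda>X. left_field X p) ` V1" for X
    proof
      assume "\<theta> p X = 0"
      then have "X = left_field (fst X, 0) p"
        by (simp add: \<theta>_def left_field_eq prod_eq_iff add_eq_0_iff2)
      then show "X \<in> (\<lambda>X. left_field X p) ` V1"
        by (rule image_eqI) (simp add: V1_def)
    next
      assume "X \<in> (\<lambda>X. left_field X p) ` V1"
      then obtain Z where "X = left_field (Z, 0) p"
        by (auto simp: V1_def)
      then show "\<theta> p X = 0"
        by (simp add: \<theta>_def left_field_eq)
    qed
    ultimately show ?thesis by blast
  qed
  moreover have "linear (\<lambda>X. \<theta> p X \<bullet> e i)" for p i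
    by (rule linearI) (simp_all add: linear_add[OF lin] linear_scale[OF lin] inner_add_left)
  ultimately have "horizontal_coframe d (\<lambda>i p X. \<theta> p X \<bullet> e i)"
    unfolding horizontal_coframe_def left_invariant_form_def dim inv by simp
  then show ?thesis by (intro exI)
qed

end

lemma qmul_add: "qmul (a + b) c = qmul a c + qmul b c" "qmul a (b + c) = qmul a b + qmul a c"
  by (simp_all add: qmul_def prod_eq_iff algebra_simps)

lemma qmul_scaleR: "qmul (r *\<^sub>R a) c = r *\<^sub>R qmul a c" "qmul a (r *\<^sub>R c) = r *\<^sub>R qmul a c"
  by (simp_all add: qmul_def prod_eq_iff algebra_simps)

lemma qcnj_linear: "qcnj (a + b) = qcnj a + qcnj b" "qcnj (r *\<^sub>R a) = r *\<^sub>R qcnj a"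
  by (simp_all add: qcnj_def prod_eq_iff)

lemma qcnj_qmul: "qcnj (qmul a b) = qmul (qcnj b) (qcnj a)"
  by (simp add: qmul_def qcnj_def prod_eq_iff algebra_simps)

lemma norm_qmul: "norm (qmul p q) = norm p * norm q"
proof -
  have "(norm (qmul p q))\<^sup>2 = (norm p * norm q)\<^sup>2"
    by (simp add: qmul_def norm_prod_def cmod_power2 power_mult_distrib)
      (simp add: power2_eq_square algebra_simps)
  then show ?thesis by simp
qed

lemma norm_qcnj: "norm (qcnj p) = norm p"
  by (simp add: qcnj_def norm_prod_def)

lemma norm_omul: "norm (omul p q) = norm p * norm q"
proof -
  have *: "qmul a c \<bullet> qmul (qcnj d) b = qmul d a \<bullet> qmul b (qcnj c)" for a b c d
    by (simp add: qmul_def qcnj_def inner_prod_def inner_complex_def algebra_simps)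
  have sq: "(norm z)\<^sup>2 = (norm (fst z))\<^sup>2 + (norm (snd z))\<^sup>2" for z :: octo
    by (simp add: norm_prod_def)
  have "(norm (omul p q))\<^sup>2 = (norm p * norm q)\<^sup>2"
    by (simp add: sq omul_def power_mult_distrib)
      (simp add: power2_norm_eq_inner inner_add inner_diff inner_commute *[of "fst p" "fst q" "snd q" "snd p"],
       simp add: norm_qmul norm_qcnj power_mult_distrib algebra_simps flip: power2_norm_eq_inner)
  then show ?thesis by simp
qed

lemma bilinear_qmul: "bilinear qmul"
  by (auto simp: bilinear_def intro!: linearI qmul_add qmul_scaleR)

lemma linear_qim: "linear qim"
  by (rule linearI) (simp_all add: qim_def)

interpretation quaternionic: heisenberg qmul qcnj qim "(1, 0)"
proof (rule heisenberg.intro)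
  have "qim (Complex 0 (fst v), snd v) = v" for v by (simp add: qim_def)
  then show "surj qim" by (rule surjI)
qed (auto simp: bilinear_qmul linear_qim qcnj_linear qcnj_qmul intro!: linearI,
     auto simp: qmul_def qcnj_def qim_def)

interpretation octonionic: heisenberg omul ocnj oim "((1, 0), 0)"
proof (rule heisenberg.intro)
  show "bilinear omul"
    unfolding bilinear_def
    by (intro conjI allI linearI)
      (simp_all add: omul_def qmul_add qmul_scaleR qcnj_linear prod_eq_iff algebra_simps)
  show "linear oim"
    by (rule linearI) (simp_all add: oim_def linear_add[OF linear_qim] linear_scale[OF linear_qim])
  have "oim ((Complex 0 (fst (fst v)), snd (fst v)), snd v) = v" for v
    by (simp add: oim_def qim_def)
  then show "surj oim" by (rule surjI)
  show "ocnj (omul z w) = omul (ocnj w) (ocnj z)" for z w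
    by (simp add: omul_def ocnj_def qmul_def qcnj_def prod_eq_iff algebra_simps)
qed (auto simp: ocnj_def qcnj_linear intro!: linearI,
     auto simp: omul_def ocnj_def oim_def qmul_def qcnj_def qim_def)

end

theory Submission
  imports Defs
begin

text \<open>The subspace is the real form \<open>S = \<real>\<^sup>n \<subseteq> K\<^sup>n\<close>. For real \<open>x\<close> the Hermitian bracket collapses to
  \<open>herm z x = Im (\<Sum>\<^sub>i x\<^sub>i z\<^sub>i)\<close>, because a real scalar is fixed by conjugation and commutes with
  everything.

  Isotropy follows, as this is the imaginary part of a real number when \<open>z\<close> is real too.

  For regularity, a horizontal coframe identifies the centre \<open>Im K\<close> with \<open>\<real>\<^sup>m\<close>, so that
  prescribing the numbers \<open>\<omega>\<^sub>i(\<xi>, X)\<close> amounts to prescribing the vector \<open>herm \<xi> X\<close> of \<open>Im K\<close>,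
  independently for each \<open>X\<close> in a basis of \<open>S\<close>. Such a prescription extends to a real linear map
  \<open>h : \<real>\<^sup>n \<rightarrow> Im K\<close>, and \<open>herm \<xi> x = h x\<close> for all \<open>x\<close> as soon as \<open>\<xi>\<^sub>i\<close> is chosen with imaginary part
  \<open>h e\<^sub>i\<close>. The argument takes place in the locale \<open>heisenberg\<close>, so it serves both algebras at once.\<close>

context heisenberg
begin

definition real_vec :: "real^'n \<Rightarrow> 'k^'n" where
  "real_vec x = (\<chi> i. (x $ i) *\<^sub>R one)"

definition real_form :: "(('k^'n) \<times> 'v) set" where
  "real_form = range (\<lambda>x. (real_vec x, 0))"

lemma linear_real_vec: "linear (real_vec :: real^'n \<Rightarrow> 'k^'n)"
  by (rule linearI) (simp_all add: real_vec_def vec_eq_iff scaleR_add_left)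

lemma linear_real_vec_Pair: "linear (\<lambda>x :: real^'n. (real_vec x :: 'k^'n, 0 :: 'v))"
  by (rule linearI)
    (simp_all add: linear_add[OF linear_real_vec] linear_scale[OF linear_real_vec])

text \<open>A Euclidean space has a basis vector, which \<open>one = 0\<close> would kill through \<open>z \<odot> one = z\<close>.\<close>

lemma one_neq_zero: "one \<noteq> 0"
proof
  assume "one = 0"
  then have "z = 0" for z :: 'k
    using mul_one[of z] bilinear_rzero[OF bilinear_mul, of z] by simp
  then show False
    by (metis nonzero_Basis nonempty_Basis ex_in_conv)
qed

lemma im_one: "im one = 0"
proof -
  have "2 *\<^sub>R im one = im one + im (cj one)"
    by (simp add: cj_one scaleR_2)
  then show ?thesis by (simp add: im_cj)
qed

lemma inj_real_vec: "inj (real_vec :: real^'n \<Rightarrow> 'k^'n)"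
  by (auto simp: inj_def real_vec_def vec_eq_iff one_neq_zero)

lemma herm_real_vec: "herm z (real_vec x) = im (\<Sum>i\<in>UNIV. (x $ i) *\<^sub>R (z $ i))"
  by (simp add: herm_def real_vec_def linear_scale[OF linear_cj] cj_one mul_one
      bilinear_rmul[OF bilinear_mul] linear_sum[OF linear_im])

lemma herm_real_vec_real_vec: "herm (real_vec x) (real_vec y) = 0"
  unfolding herm_real_vec
  by (simp add: real_vec_def linear_sum[OF linear_im] linear_scale[OF linear_im] im_one)

text \<open>Every linear map on the real form is the bracket with a suitable \<open>z\<close>: only the coordinate
  vectors have to be matched, and there \<open>herm z\<close> returns the imaginary parts of the entries of
  \<open>z\<close>, which are free.\<close>

lemma herm_real_vec_represents_linear:
  fixes h :: "real^'n \<Rightarrow> 'v"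
  assumes "linear h"
  obtains z :: "'k^'n" where "\<And>x. herm z (real_vec x) = h x"
proof
  fix x :: "real^'n"
  let ?z = "\<chi> i. inv im (h (axis i 1)) :: 'k^'n"
  have "herm ?z (real_vec x) = (\<Sum>i\<in>UNIV. (x $ i) *\<^sub>R h (axis i 1))"
    by (simp add: herm_real_vec linear_sum[OF linear_im] linear_scale[OF linear_im]
        surj_f_inv_f[OF surj_im])
  also have "\<dots> = h (\<Sum>i\<in>UNIV. (x $ i) *s axis i 1)"
    by (simp add: linear_sum[OF assms] linear_scale[OF assms] scalar_mult_eq_scaleR)
  finally show "herm ?z (real_vec x) = h x"
    by (simp add: basis_expansion)
qed

lemma codim_V1: "DIM(('k^'n) \<times> 'v) - dim (V1 :: (('k^'n) \<times> 'v) set) = DIM('v)"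
proof -
  have "dim ((UNIV :: ('k^'n) set) \<times> {0 :: 'v}) = dim (UNIV :: ('k^'n) set) + dim {0 :: 'v}"
    by (rule dim_Times) (rule subspace_UNIV subspace_single_0)+
  then show ?thesis
    by (simp only: V1_def dim_UNIV DIM_prod) simp
qed

text \<open>The forms of a coframe restrict to the centre without a common zero, and there are as many of
  them as the centre has dimensions, so their values can be prescribed there.\<close>

lemma horizontal_coframe_onto_centre:
  fixes \<eta> :: "nat \<Rightarrow> ('k^'n) \<times> 'v \<Rightarrow> ('k^'n) \<times> 'v \<Rightarrow> real"
  assumes "horizontal_coframe m \<eta>"
  obtains v :: 'v where "\<And>i. i < m \<Longrightarrow> \<eta> i 0 (0, v) = c i"
proof -
  have m: "m = DIM('v)"
    using assms unfolding horizontal_coframe_def codim_V1 by blast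
  have lin: "linear (\<eta> i 0)" if "i < m" for i
    using assms that unfolding horizontal_coframe_def left_invariant_form_def by blast
  have "{X. \<forall>i<m. \<eta> i 0 X = 0} = (\<lambda>X. left_field X 0) ` V1"
    using assms unfolding horizontal_coframe_def by blast
  then have ker: "{X. \<forall>i<m. \<eta> i 0 X = 0} = V1"
    by (simp add: left_field_eq herm_linear)
  obtain e where e: "bij_betw e {..<m} (Basis :: 'v set)"
    unfolding m using ex_bij_betw_nat_finite[OF finite_Basis, unfolded atLeast0LessThan] ..
  have coord: "(\<Sum>i<m. a i *\<^sub>R e i) \<bullet> e j = a j" if "j < m" for a j
  proof -
    have "e i \<bullet> e j = (if i = j then 1 else 0)" if "i < m" for i
      using e that \<open>j < m\<close> bij_betw_apply[OF e, of i] bij_betw_apply[OF e, of j]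
      by (auto simp: bij_betw_def inner_Basis inj_on_eq_iff)
    then have "(\<Sum>i<m. a i *\<^sub>R e i) \<bullet> e j = (\<Sum>i<m. if i = j then a i else 0)"
      unfolding inner_sum_left by (intro sum.cong) auto
    then show ?thesis
      using that by simp
  qed
  define F where "F v = (\<Sum>i<m. \<eta> i 0 (0, v) *\<^sub>R e i)" for v
  have linF: "linear F"
  proof (rule linearI)
    fix u v :: 'v and r :: real
    have "\<eta> i 0 (0, u + v) = \<eta> i 0 (0, u) + \<eta> i 0 (0, v)" if "i < m" for i
      using linear_add[OF lin[OF that], of "(0, u)" "(0, v)"] by simp
    then show "F (u + v) = F u + F v"
      by (simp add: F_def scaleR_add_left sum.distrib)
    have "\<eta> i 0 (0, r *\<^sub>R u) = r * \<eta> i 0 (0, u)" if "i < m" for i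
      using linear_scale[OF lin[OF that], of r "(0, u)"] by simp
    then show "F (r *\<^sub>R u) = r *\<^sub>R F u"
      by (simp add: F_def scaleR_sum_right)
  qed
  have "v = 0" if "F v = 0" for v
  proof -
    have "\<eta> i 0 (0, v) = 0" if "i < m" for i
      using coord[OF that, of "\<lambda>i. \<eta> i 0 (0, v)"] \<open>F v = 0\<close> by (simp add: F_def)
    then have "(0, v) \<in> (V1 :: (('k^'n) \<times> 'v) set)"
      unfolding ker[symmetric] by simp
    then show "v = 0"
      by (simp add: V1_def)
  qed
  then have "inj F"
    using linear_injective_0[OF linF] by blast
  then have "surj F"
    using linear_injective_imp_surjective[OF linF] by simp
  then obtain v where v: "F v = (\<Sum>i<m. c i *\<^sub>R e i)"
    by (metis surjD)
  show ?thesis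
  proof
    fix i assume "i < m"
    then show "\<eta> i 0 (0, v) = c i"
      using coord[of i "\<lambda>i. \<eta> i 0 (0, v)"] coord[of i c] v by (simp add: F_def)
  qed
qed

lemma curvature_eq:
  assumes "horizontal_coframe m \<eta>" "i < m"
  shows "curvature \<eta> i X Y = \<eta> i 0 (0, herm (fst X) (fst Y)) / 2"
proof -
  have inv: "left_invariant_form (\<eta> i)"
    using assms unfolding horizontal_coframe_def by blast
  then have lin: "linear (\<eta> i 0)"
    unfolding left_invariant_form_def by blast
  have "\<eta> i 0 (lie_bracket X Y) = - \<eta> i 0 (0, herm (fst X) (fst Y))"
    unfolding lie_bracket_eq
    using linear_neg[OF lin, of "(0, herm (fst X) (fst Y))"] by simp
  then show ?thesis
    unfolding curvature_def ext_deriv_left_invariant[OF inv] by simp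
qed

lemma subspace_real_form: "subspace (real_form :: (('k^'n) \<times> 'v) set)"
  unfolding real_form_def by (rule linear_subspace_image[OF linear_real_vec_Pair subspace_UNIV])

lemma dim_real_form: "dim (real_form :: (('k^'n) \<times> 'v) set) = CARD('n)"
proof -
  have "inj (\<lambda>x :: real^'n. (real_vec x :: 'k^'n, 0 :: 'v))"
    using inj_real_vec by (simp add: inj_def)
  then have "dim (real_form :: (('k^'n) \<times> 'v) set) = dim (UNIV :: (real^'n) set)"
    unfolding real_form_def by (intro dim_image_eq[OF linear_real_vec_Pair]) (simp add: span_UNIV)
  then show ?thesis by simp
qed

lemma real_form_subset_V1: "real_form \<subseteq> V1"
  by (auto simp: real_form_def V1_def)

lemma Omega_isotropic_real_form:
  assumes "horizontal_coframe m \<eta>"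
  shows "Omega_isotropic m (curvature \<eta>) real_form"
proof -
  have "\<eta> i 0 (0, 0) = 0" if "i < m" for i
    using assms that linear_0[of "\<eta> i 0"]
    unfolding horizontal_coframe_def left_invariant_form_def by (simp add: zero_prod_def)
  then show ?thesis
    by (auto simp: Omega_isotropic_def curvature_eq[OF assms] real_form_def herm_real_vec_real_vec)
qed

lemma Omega_regular_real_form:
  fixes \<eta> :: "nat \<Rightarrow> ('k^'n) \<times> 'v \<Rightarrow> ('k^'n) \<times> 'v \<Rightarrow> real"
  assumes "horizontal_coframe m \<eta>"
  shows "Omega_regular V1 m (curvature \<eta>) real_form"
  unfolding Omega_regular_def
proof (intro allI impI)
  fix B :: "(('k^'n) \<times> 'v) set" and \<sigma> :: "nat \<Rightarrow> ('k^'n) \<times> 'v \<Rightarrow> real"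
  assume B: "independent B \<and> span B = real_form"
  (* The factor 2 cancels the 1/2 in the exterior derivative. *)
  have "\<exists>v. \<forall>i<m. \<eta> i 0 (0, v) = 2 * \<sigma> i X" for X
    by (rule horizontal_coframe_onto_centre[OF assms, of "\<lambda>i. 2 * \<sigma> i X"]) blast
  then obtain v where v: "\<And>X i. i < m \<Longrightarrow> \<eta> i 0 (0, v X) = 2 * \<sigma> i X"
    by metis
  obtain h where h: "linear h" "\<And>X. X \<in> B \<Longrightarrow> h X = v X"
    using linear_independent_extend[of B v] B by blast
  have "linear (\<lambda>x :: real^'n. h (real_vec x, 0))"
    using linear_compose[OF linear_real_vec_Pair h(1)] by (simp add: o_def)
  then obtain z :: "'k^'n" where z: "\<And>x. herm z (real_vec x) = h (real_vec x, 0)"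
    by (rule herm_real_vec_represents_linear) blast
  have "curvature \<eta> i (z, 0) X = \<sigma> i X" if "i < m" "X \<in> B" for i X
  proof -
    have "X \<in> real_form"
      using B that(2) span_base by blast
    then have "herm z (fst X) = v X"
      using h(2)[OF that(2)] by (auto simp: real_form_def z)
    then show ?thesis
      using v[OF that(1)] by (simp add: curvature_eq[OF assms that(1)])
  qed
  then show "\<exists>\<xi>\<in>V1. \<forall>i<m. \<forall>X\<in>B. curvature \<eta> i \<xi> X = \<sigma> i X"
    by (intro bexI[of _ "(z, 0)"]) (auto simp: V1_def)
qed

lemma regular_isotropic_subspace_exists:
  fixes \<eta> :: "nat \<Rightarrow> ('k^'n) \<times> 'v \<Rightarrow> ('k^'n) \<times> 'v \<Rightarrow> real"
  assumes "horizontal_coframe m \<eta>"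
  shows "\<exists>S. subspace S \<and> S \<subseteq> V1 \<and> dim S = CARD('n) \<and>
    Omega_regular V1 m (curvature \<eta>) S \<and> Omega_isotropic m (curvature \<eta>) S"
  using subspace_real_form real_form_subset_V1 dim_real_form
    Omega_regular_real_form[OF assms] Omega_isotropic_real_form[OF assms] by blast

end

theorem proposition5p1:
  shows
    "(\<forall>m (\<eta> :: nat \<Rightarrow> (quat^'n) \<times> im_quat \<Rightarrow> (quat^'n) \<times> im_quat \<Rightarrow> real).
        quaternionic.horizontal_coframe m \<eta> \<longrightarrow>
        (\<exists>S. subspace S \<and> S \<subseteq> quaternionic.V1 \<and> dim S = CARD('n) \<and>
             Omega_regular quaternionic.V1 m (quaternionic.curvature \<eta>) S \<and>
             Omega_isotropic m (quaternionic.curvature \<eta>) S)) \<and>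
     (\<forall>m (\<eta> :: nat \<Rightarrow> (octo^'n) \<times> im_octo \<Rightarrow> (octo^'n) \<times> im_octo \<Rightarrow> real).
        octonionic.horizontal_coframe m \<eta> \<longrightarrow>
        (\<exists>S. subspace S \<and> S \<subseteq> octonionic.V1 \<and> dim S = CARD('n) \<and>
             Omega_regular octonionic.V1 m (octonionic.curvature \<eta>) S \<and>
             Omega_isotropic m (octonionic.curvature \<eta>) S))"
  using quaternionic.regular_isotropic_subspace_exists octonionic.regular_isotropic_subspace_exists
  by blast

end
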